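(* Let $x,y$ be real numbers, and put $l=\lfloor x\rfloor$ and $m=\lfloor y\rfloor$. If $l\ge 1$ and $m\ge 1$, then $$\beta(x+1,y+1)\le\frac{l!\,m!\,(l+1)^{x-l}(m+1)^{y-m}}{(l+m)!}.$$
   Context: $\beta$ denotes the Beta function, $\beta(u,v)=\frac{\Gamma(u)\Gamma(v)}{\Gamma(u+v)}$ for real $u,v>0$, where $\Gamma$ is the Gamma function. *)

theory Defs
  imports "HOL-Analysis.Analysis"
begin

end

theory Submission imports Defs begin

text \<open>
  Write \<open>x = l + s\<close> and \<open>y = m + t\<close> with fractional parts \<open>s, t \<in> [0, 1)\<close>. The bound on
  \<open>Beta (x + 1) (y + 1) = Gamma (x + 1) * Gamma (y + 1) / Gamma (x + y + 2)\<close> comes from estimating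
  the three Gamma values separately. Since \<open>ln \<circ> Gamma\<close> is convex and \<open>Gamma (z + 1) = z * Gamma z\<close>,
  geometric interpolation between \<open>z = l + 1\<close> and \<open>z + 1\<close> gives
  \<open>Gamma (x + 1) \<le> (l + 1) powr s * l!\<close>, and likewise for \<open>y\<close>
  (lemma \<open>Gamma_add_le_powr_mult_Gamma\<close>). In the denominator, \<open>Gamma\<close> is increasing from \<open>3/2\<close>
  onwards, so \<open>Gamma (x + y + 2) \<ge> Gamma (l + m + 1) = (l + m)!\<close>.
\<close>

text \<open>
  Log-convexity bounds \<open>Gamma (z + s)\<close> by the weighted geometric mean
  \<open>Gamma z powr (1 - s) * Gamma (z + 1) powr s\<close>, which the functional equation collapses
  to the right-hand side.
\<close>
lemma Gamma_add_le_powr_mult_Gamma: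
  fixes z s :: real
  assumes z: "z > 0" and s: "0 \<le> s" "s \<le> 1"
  shows "Gamma (z + s) \<le> z powr s * Gamma z"
proof -
  have nz: "Gamma z \<noteq> 0"
    using Gamma_real_pos[OF z] by linarith
  have Gamma_Suc: "Gamma (z + 1) = z * Gamma z"
    using z by (intro Gamma_plus1) (auto elim!: nonpos_Ints_cases)
  have "(ln \<circ> Gamma) ((1 - s) *\<^sub>R z + s *\<^sub>R (z + 1))
          \<le> (1 - s) * (ln \<circ> Gamma) z + s * (ln \<circ> Gamma) (z + 1)"
    using z s by (intro convex_onD[OF log_convex_Gamma_real]) auto
  then have "ln (Gamma (z + s)) \<le> (1 - s) * ln (Gamma z) + s * ln (Gamma (z + 1))"
    by (simp add: algebra_simps)
  also have "\<dots> = s * ln z + ln (Gamma z)"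
    unfolding Gamma_Suc using z nz by (simp add: ln_mult algebra_simps)
  also have "\<dots> = ln (z powr s * Gamma z)"
    using z nz by (simp add: ln_mult ln_powr)
  finally show ?thesis
    using z s Gamma_real_pos[OF z] Gamma_real_pos[of "z + s"]
    by (subst (asm) ln_le_cancel_iff) auto
qed

lemma Gamma_add_1_le_fact_mult_powr_frac:
  fixes x :: real
  assumes "\<lfloor>x\<rfloor> \<ge> 0"
  shows "Gamma (x + 1) \<le> fact (nat \<lfloor>x\<rfloor>) * (of_int \<lfloor>x\<rfloor> + 1) powr (x - of_int \<lfloor>x\<rfloor>)"
proof -
  have "Gamma ((of_int \<lfloor>x\<rfloor> + 1) + (x - of_int \<lfloor>x\<rfloor>))
      \<le> (of_int \<lfloor>x\<rfloor> + 1) powr (x - of_int \<lfloor>x\<rfloor>) * Gamma (of_int \<lfloor>x\<rfloor> + 1)"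
    using assms by (intro Gamma_add_le_powr_mult_Gamma) linarith+
  moreover have "Gamma (of_int \<lfloor>x\<rfloor> + 1 :: real) = fact (nat \<lfloor>x\<rfloor>)"
    using assms Gamma_of_int[of "\<lfloor>x\<rfloor> + 1", where 'a = real] by simp
  ultimately show ?thesis
    by (simp add: algebra_simps)
qed

theorem mainTheorem5:
  fixes x y :: real and l m :: int
  assumes "l = \<lfloor>x\<rfloor>" and "m = \<lfloor>y\<rfloor>"
    and "l \<ge> 1" and "m \<ge> 1"
  shows "Beta (x + 1) (y + 1) \<le>
    fact (nat l) * fact (nat m) * (real_of_int l + 1) powr (x - real_of_int l)
      * (real_of_int m + 1) powr (y - real_of_int m) / fact (nat (l + m))"
proof -
  let ?A = "fact (nat l) * (real_of_int l + 1) powr (x - real_of_int l)"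
  let ?B = "fact (nat m) * (real_of_int m + 1) powr (y - real_of_int m)"
  have bounds: "x \<ge> of_int l" "y \<ge> of_int m" "real_of_int l \<ge> 1" "real_of_int m \<ge> 1"
    using assms by auto
  have A: "Gamma (x + 1) \<le> ?A" and B: "Gamma (y + 1) \<le> ?B"
    using assms Gamma_add_1_le_fact_mult_powr_frac[of x]
      Gamma_add_1_le_fact_mult_powr_frac[of y] by simp_all
  have "(fact (nat (l + m)) :: real) = Gamma (of_int (l + m + 1))"
    using assms by (subst Gamma_of_int) simp
  also have "\<dots> < Gamma ((x + 1) + (y + 1))"
    using bounds by (intro Gamma_real_strict_mono) simp_all
  finally have C: "fact (nat (l + m)) \<le> Gamma ((x + 1) + (y + 1))"
    by simp
  have "Beta (x + 1) (y + 1) \<le> (?A * ?B) / fact (nat (l + m))"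
    unfolding Beta_def
    using bounds by (intro frac_le mult_mono A B C) (auto intro!: mult_nonneg_nonneg)
  then show ?thesis
    by (simp add: mult_ac)
qed

end
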